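(* Let $\mathcal{C}$ be any one of the following three classes: the class of bipartite graphs, the class of split graphs, the class of co-bipartite graphs. For $n \geq 1$ let $f_{\mathcal{C}}(n)$ be the maximum of $\operatorname{tww}(G)$ over all $n$-vertex graphs $G \in \mathcal{C}$. Then $f_{\mathcal{C}}(n) \in \Theta(n)$ as $n \to \infty$.
   Context: All graphs are finite, simple and undirected. A split graph is a graph whose vertex-set can be partitioned into a clique and a stable set (a set of pairwise non-adjacent vertices). A co-bipartite graph is the complement of a bipartite graph. Twin-width: a trigraph is a graph together with a partition of its edge-set into black edges and red edges; an ordinary graph is regarded as a trigraph with all edges black. Contracting two distinct (not necessarily adjacent) vertices $u,v$ of a trigraph means replacing them by a single new vertex $w$ such that, for every other vertex $x$: $wx$ is a black edge if both $ux$ and $vx$ are black edges; $wx$ is a non-edge if neither $ux$ nor $vx$ is an edge; and $wx$ is a red edge otherwise. All other edges and their colours are unchanged. The red degree of a vertex is the number of red edges incident with it. A contraction sequence of an $n$-vertex graph $G$ is a sequence of trigraphs $G = G_n, \dots, G_1 = K_1$ where each $G_s$ is obtained from $G_{s+1}$ by one contraction; it is a $d$-sequence if every trigraph in it has maximum red degree at most $d$. The twin-width $\operatorname{tww}(G)$ is the minimum integer $d$ such that $G$ has a $d$-sequence. *)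

theory Defs
  imports "HOL-Library.Landau_Symbols"
begin

section \<open>Finite simple graphs\<close>

record 'a graph =
  verts :: "'a set"
  edges :: "'a set set"

definition simple_graph :: "'a graph \<Rightarrow> bool" where
  "simple_graph G \<longleftrightarrow>
     finite (verts G) \<and>
     (\<forall>e \<in> edges G. \<exists>u \<in> verts G. \<exists>v \<in> verts G. u \<noteq> v \<and> e = {u, v})"

definition stable_set :: "'a graph \<Rightarrow> 'a set \<Rightarrow> bool" where
  "stable_set G S \<longleftrightarrow> S \<subseteq> verts G \<and> (\<forall>u \<in> S. \<forall>v \<in> S. {u, v} \<notin> edges G)"

definition clique :: "'a graph \<Rightarrow> 'a set \<Rightarrow> bool" where
  "clique G K \<longleftrightarrow> K \<subseteq> verts G \<and> (\<forall>u \<in> K. \<forall>v \<in> K. u \<noteq> v \<longrightarrow> {u, v} \<in> edges G)"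

definition complement :: "'a graph \<Rightarrow> 'a graph" where
  "complement G =
     \<lparr> verts = verts G,
       edges = {{u, v} | u v. u \<in> verts G \<and> v \<in> verts G \<and> u \<noteq> v \<and> {u, v} \<notin> edges G} \<rparr>"

text \<open>The two parts of a bipartition, and of a split partition, may be empty.\<close>

definition bipartite_graphs :: "'a graph set" where
  "bipartite_graphs =
     {G. simple_graph G \<and>
         (\<exists>A B. A \<union> B = verts G \<and> A \<inter> B = {} \<and> stable_set G A \<and> stable_set G B)}"

definition split_graphs :: "'a graph set" where
  "split_graphs =
     {G. simple_graph G \<and>
         (\<exists>K S. K \<union> S = verts G \<and> K \<inter> S = {} \<and> clique G K \<and> stable_set G S)}"

definition cobipartite_graphs :: "'a graph set" where
  "cobipartite_graphs = complement ` bipartite_graphs"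


section \<open>Trigraphs, contractions and twin-width\<close>

record 'a trigraph =
  tverts :: "'a set"
  black :: "'a set set"
  red :: "'a set set"

definition trigraph_of :: "'a graph \<Rightarrow> 'a trigraph" where
  "trigraph_of G = \<lparr> tverts = verts G, black = edges G, red = {} \<rparr>"

definition contract :: "'a trigraph \<Rightarrow> 'a \<Rightarrow> 'a \<Rightarrow> 'a \<Rightarrow> 'a trigraph" where
  "contract T u v w =
     \<lparr> tverts = insert w (tverts T - {u, v}),
       black = {e \<in> black T. u \<notin> e \<and> v \<notin> e} \<union>
         {{w, x} | x. x \<in> tverts T - {u, v} \<and> {u, x} \<in> black T \<and> {v, x} \<in> black T},
       red = {e \<in> red T. u \<notin> e \<and> v \<notin> e} \<union>
         {{w, x} | x. x \<in> tverts T - {u, v} \<and>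
            \<not> ({u, x} \<in> black T \<and> {v, x} \<in> black T) \<and>
            \<not> ({u, x} \<notin> black T \<union> red T \<and> {v, x} \<notin> black T \<union> red T)} \<rparr>"

text \<open>
  The new vertex must differ from all the vertices that remain, but it may reuse the name of
  one of the two vertices that disappear. This only affects the naming of vertices, and
  it keeps the notion meaningful over finite vertex types, where a fresh name need not exist.
\<close>

definition contracts_to :: "'a trigraph \<Rightarrow> 'a trigraph \<Rightarrow> bool" where
  "contracts_to T T' \<longleftrightarrow>
     (\<exists>u v w. u \<in> tverts T \<and> v \<in> tverts T \<and> u \<noteq> v \<and>
              w \<notin> tverts T - {u, v} \<and> T' = contract T u v w)"

definition red_degree :: "'a trigraph \<Rightarrow> 'a \<Rightarrow> nat" where
  "red_degree T v = card {e \<in> red T. v \<in> e}"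

text \<open>
  A sequence \<open>G\<^sub>n, \<dots>, G\<^sub>1\<close> is a function on indices of which only the values at
  \<open>1, \<dots>, n\<close> matter.
\<close>

definition contraction_sequence :: "'a graph \<Rightarrow> (nat \<Rightarrow> 'a trigraph) \<Rightarrow> bool" where
  "contraction_sequence G Gs \<longleftrightarrow>
     Gs (card (verts G)) = trigraph_of G \<and>
     (\<exists>z. Gs 1 = \<lparr> tverts = {z}, black = {}, red = {} \<rparr>) \<and>
     (\<forall>s. 1 \<le> s \<and> s < card (verts G) \<longrightarrow> contracts_to (Gs (Suc s)) (Gs s))"

definition d_sequence :: "nat \<Rightarrow> 'a graph \<Rightarrow> (nat \<Rightarrow> 'a trigraph) \<Rightarrow> bool" where
  "d_sequence d G Gs \<longleftrightarrow>
     contraction_sequence G Gs \<and>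
     (\<forall>s \<in> {1..card (verts G)}. \<forall>v \<in> tverts (Gs s). red_degree (Gs s) v \<le> d)"

definition tww :: "'a graph \<Rightarrow> nat" where
  "tww G = (LEAST d. \<exists>Gs. d_sequence d G Gs)"

text \<open>
  For \<open>n \<ge> 1\<close> and each of the three classes above over an infinite vertex type, the set below
  is nonempty and bounded by \<open>n\<close>, so \<open>Max\<close> is a genuine maximum.
  The value at \<open>n = 0\<close> carries no meaning.
\<close>

definition max_tww :: "'a graph set \<Rightarrow> nat \<Rightarrow> nat" where
  "max_tww C n = Max {tww G | G. G \<in> C \<and> card (verts G) = n}"

end

theory Submission imports Defs begin

text \<open>
  Contracting \<open>u\<close> and \<open>v\<close> first creates a vertex whose red degree is the number of
  other vertices on which the neighbourhoods of \<open>u\<close> and \<open>v\<close> differ, so the twin-width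
  is at least the minimum of this number over all pairs. It therefore suffices to find a bipartite
  (split, co-bipartite) graph on every large number of vertices in which all pairs of vertices
  differ on linearly many vertices. The bipartite adjacency matrix is cut out of the signed
  Sylvester--Hadamard matrix with blocks \<open>(H, -H; -H, H)\<close>, where \<open>H\<close> has order
  \<open>2 ^ k\<close>. Since each of the blocks already separates the rows and the columns, the
  sizes of the two sides may take any value from \<open>2 ^ k\<close> to about \<open>2 ^ (k + 1)\<close>.
\<close>

section \<open>Existence of contraction sequences\<close>

text \<open>The invariant kept by contractions. It makes the red edges finite in number; an infinite
  set would have \<open>card\<close> 0 and hence \<open>red_degree\<close> 0.\<close>

definition wf_trigraph :: "'a trigraph \<Rightarrow> bool" where
  "wf_trigraph T \<longleftrightarrow> finite (tverts T) \<and>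
     (\<forall>e \<in> black T \<union> red T. \<exists>u \<in> tverts T. \<exists>v \<in> tverts T. u \<noteq> v \<and> e = {u, v})"

lemma wf_trigraph_trigraph_of: "simple_graph G \<Longrightarrow> wf_trigraph (trigraph_of G)"
  by (simp add: wf_trigraph_def simple_graph_def trigraph_of_def)

lemma wf_trigraph_contract:
  assumes "wf_trigraph T" "w \<notin> tverts T - {u, v}"
  shows "wf_trigraph (contract T u v w)"
proof -
  have "\<exists>a \<in> tverts (contract T u v w). \<exists>b \<in> tverts (contract T u v w). a \<noteq> b \<and> e = {a, b}"
    if e: "e \<in> black (contract T u v w) \<union> red (contract T u v w)" for e
  proof (cases "e \<in> black T \<union> red T \<and> u \<notin> e \<and> v \<notin> e")
    case True
    then obtain a b where "a \<in> tverts T" "b \<in> tverts T" "a \<noteq> b" "e = {a, b}"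
      using assms(1) unfolding wf_trigraph_def by blast
    then show ?thesis using True by (auto simp: contract_def)
  next
    case False
    then obtain x where "x \<in> tverts T - {u, v}" "e = {w, x}"
      using e unfolding contract_def trigraph.simps by blast
    then show ?thesis using assms(2) by (auto simp: contract_def)
  qed
  moreover have "finite (tverts (contract T u v w))"
    using assms(1) by (simp add: wf_trigraph_def contract_def)
  ultimately show ?thesis unfolding wf_trigraph_def by blast
qed

lemma card_tverts_contract:
  assumes "finite (tverts T)" "u \<in> tverts T" "v \<in> tverts T" "u \<noteq> v" "w \<notin> tverts T - {u, v}"
  shows "Suc (card (tverts (contract T u v w))) = card (tverts T)"
proof -
  have "card (tverts T) = card (insert u (insert v (tverts T - {u, v})))"
    using assms by (metis insert_Diff_single insert_absorb insert_commute Diff_insert2 insert_Diff)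
  then show ?thesis using assms by (simp add: contract_def)
qed

lemma ex_contracts_to:
  assumes "wf_trigraph T" "card (tverts T) = Suc s" "1 \<le> s"
  shows "\<exists>T'. contracts_to T T' \<and> wf_trigraph T' \<and> card (tverts T') = s"
proof -
  have fin: "finite (tverts T)" using assms(1) by (simp add: wf_trigraph_def)
  have "\<not> (\<forall>u \<in> tverts T. \<forall>v \<in> tverts T. u = v)"
    using assms card_le_Suc0_iff_eq[OF fin] by simp
  then obtain u v where uv: "u \<in> tverts T" "v \<in> tverts T" "u \<noteq> v" by blast
  \<comment> \<open>The new vertex takes over the name \<open>u\<close>, so no fresh name has to
    exist.\<close>
  have "contracts_to T (contract T u v u)"
    unfolding contracts_to_def using uv by blast
  moreover have "wf_trigraph (contract T u v u)"
    by (rule wf_trigraph_contract[OF assms(1)]) simp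
  moreover have "card (tverts (contract T u v u)) = s"
    using card_tverts_contract[OF fin uv, of u] assms(2) by simp
  ultimately show ?thesis by blast
qed

lemma ex_contractions:
  assumes "wf_trigraph T" "card (tverts T) = n" "1 \<le> n"
  shows "\<exists>Gs. Gs n = T \<and>
    (\<forall>s. 1 \<le> s \<and> s \<le> n \<longrightarrow> wf_trigraph (Gs s) \<and> card (tverts (Gs s)) = s) \<and>
    (\<forall>s. 1 \<le> s \<and> s < n \<longrightarrow> contracts_to (Gs (Suc s)) (Gs s))"
  using assms
proof (induction n arbitrary: T)
  case (Suc n)
  show ?case
  proof (cases "n = 0")
    case True
    then show ?thesis using Suc.prems by (intro exI[of _ "\<lambda>_. T"]) (auto simp: le_Suc_eq)
  next
    case False
    then obtain T' where T': "contracts_to T T'" "wf_trigraph T'" "card (tverts T') = n"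
      using ex_contracts_to[of T n] Suc.prems by auto
    then obtain Gs where Gs: "Gs n = T'"
      "\<forall>s. 1 \<le> s \<and> s \<le> n \<longrightarrow> wf_trigraph (Gs s) \<and> card (tverts (Gs s)) = s"
      "\<forall>s. 1 \<le> s \<and> s < n \<longrightarrow> contracts_to (Gs (Suc s)) (Gs s)"
      using Suc.IH[of T'] False by auto
    show ?thesis
      using Gs T' Suc.prems
      \<comment> \<open>Indices count vertices, so \<open>T\<close> is put in front by setting the
        value at \<open>Suc n\<close>.\<close>
      by (intro exI[of _ "Gs(Suc n := T)"]) (auto simp: le_Suc_eq less_Suc_eq)
  qed
qed simp

section \<open>The trivial upper bound on twin-width\<close>

lemma red_incident_subset:
  assumes "wf_trigraph T"
  shows "{e \<in> red T. v \<in> e} \<subseteq> (\<lambda>x. {v, x}) ` tverts T"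
proof
  fix e assume e: "e \<in> {e \<in> red T. v \<in> e}"
  then obtain a b where "a \<in> tverts T" "b \<in> tverts T" "e = {a, b}"
    using assms unfolding wf_trigraph_def by blast
  then show "e \<in> (\<lambda>x. {v, x}) ` tverts T" using e by auto
qed

lemma finite_red_incident: "wf_trigraph T \<Longrightarrow> finite {e \<in> red T. v \<in> e}"
  by (rule finite_subset[OF red_incident_subset]) (simp_all add: wf_trigraph_def)

lemma red_degree_le_card: "wf_trigraph T \<Longrightarrow> red_degree T v \<le> card (tverts T)"
  unfolding red_degree_def
  by (rule surj_card_le[OF _ red_incident_subset]) (simp_all add: wf_trigraph_def)

lemma wf_trigraph_single:
  assumes "wf_trigraph T" "card (tverts T) = 1"
  shows "\<exists>z. T = \<lparr>tverts = {z}, black = {}, red = {}\<rparr>"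
proof -
  obtain z where z: "tverts T = {z}" using assms(2) card_1_singletonE by blast
  have "e \<notin> black T \<union> red T" for e
    using assms(1) z unfolding wf_trigraph_def by (metis singletonD)
  then have "black T = {}" "red T = {}" by auto
  then show ?thesis using z by (intro exI[of _ z] trigraph.equality) auto
qed

text \<open>Gives the linear upper bound, and also that the \<open>LEAST\<close> in
  \<open>tww\<close> is attained, on which the lower bound relies.\<close>

lemma ex_d_sequence:
  assumes "simple_graph G" "card (verts G) = n" "1 \<le> n"
  shows "\<exists>Gs. d_sequence n G Gs"
proof -
  obtain Gs where Gs: "Gs n = trigraph_of G"
    "\<forall>s. 1 \<le> s \<and> s \<le> n \<longrightarrow> wf_trigraph (Gs s) \<and> card (tverts (Gs s)) = s"
    "\<forall>s. 1 \<le> s \<and> s < n \<longrightarrow> contracts_to (Gs (Suc s)) (Gs s)"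
    using ex_contractions[OF wf_trigraph_trigraph_of[OF assms(1)], of n] assms
    by (auto simp: trigraph_of_def)
  have "red_degree (Gs s) v \<le> n" if "s \<in> {1..n}" for s v
    using red_degree_le_card[of "Gs s" v] Gs(2) that by fastforce
  then have "d_sequence n G Gs"
    unfolding d_sequence_def contraction_sequence_def
    using Gs wf_trigraph_single[of "Gs 1"] assms by auto
  then show ?thesis by blast
qed

lemma tww_le_card:
  assumes "simple_graph G" "card (verts G) = n" "1 \<le> n"
  shows "tww G \<le> n"
  unfolding tww_def using ex_d_sequence[OF assms] by (rule Least_le)


section \<open>The first contraction\<close>

lemma simple_graph_complement:
  assumes "simple_graph G"
  shows "simple_graph (complement G)"
proof -
  have "\<exists>u \<in> verts G. \<exists>v \<in> verts G. u \<noteq> v \<and> e = {u, v}" if "e \<in> edges (complement G)" for e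
    using that unfolding complement_def graph.simps by blast
  then show ?thesis using assms by (simp add: simple_graph_def complement_def)
qed

text \<open>Both \<open>u\<close> and \<open>v\<close> disappear when contracted, so they are left
  out; what remains are the red neighbours of the new vertex.\<close>

definition nbr_diff :: "'a graph \<Rightarrow> 'a \<Rightarrow> 'a \<Rightarrow> 'a set" where
  "nbr_diff G u v = {x \<in> verts G - {u, v}. ({u, x} \<in> edges G) \<noteq> ({v, x} \<in> edges G)}"

lemma nbr_diff_commute: "nbr_diff G u v = nbr_diff G v u"
  by (auto simp: nbr_diff_def)

text \<open>Complementation negates both adjacencies, so their disagreement survives. This carries
  the bipartite lower bound over to co-bipartite graphs.\<close>

lemma nbr_diff_complement:
  assumes "u \<in> verts G" "v \<in> verts G"
  shows "nbr_diff (complement G) u v = nbr_diff G u v"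
proof -
  have "{a, x} \<in> edges (complement G) \<longleftrightarrow> {a, x} \<notin> edges G"
    if "a \<in> verts G" "x \<in> verts G" "a \<noteq> x" for a x
    using that by (auto simp: complement_def doubleton_eq_iff insert_commute)
  then show ?thesis using assms by (auto simp: nbr_diff_def complement_def)
qed

lemma red_degree_contract:
  assumes "simple_graph G" "w \<notin> verts G - {u, v}"
  shows "card (nbr_diff G u v) \<le> red_degree (contract (trigraph_of G) u v w) w"
  unfolding red_degree_def
proof (rule card_inj_on_le)
  show "inj_on (\<lambda>x. {w, x}) (nbr_diff G u v)"
    by (auto simp: inj_on_def doubleton_eq_iff)
  show "(\<lambda>x. {w, x}) ` nbr_diff G u v \<subseteq> {e \<in> red (contract (trigraph_of G) u v w). w \<in> e}"
    by (auto simp: contract_def trigraph_of_def nbr_diff_def)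
  show "finite {e \<in> red (contract (trigraph_of G) u v w). w \<in> e}"
    using wf_trigraph_contract[OF wf_trigraph_trigraph_of[OF assms(1)], of w u v] assms(2)
    by (intro finite_red_incident) (simp add: trigraph_of_def)
qed

text \<open>In an optimal sequence the trigraph after \<open>G\<close> is a single contraction of
  \<open>G\<close>, and its new vertex already has these red edges.\<close>

lemma ex_nbr_diff_le_tww:
  assumes "simple_graph G" "2 \<le> card (verts G)"
  shows "\<exists>u \<in> verts G. \<exists>v \<in> verts G. u \<noteq> v \<and> card (nbr_diff G u v) \<le> tww G"
proof -
  obtain Gs where Gs: "d_sequence (tww G) G Gs"
    using ex_d_sequence[OF assms(1) refl] assms(2) LeastI_ex[of "\<lambda>d. \<exists>Gs. d_sequence d G Gs"]
    unfolding tww_def by auto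
  define s where "s = card (verts G) - 1"
  have s: "Suc s = card (verts G)" "1 \<le> s" using assms(2) by (auto simp: s_def)
  then have "contracts_to (trigraph_of G) (Gs s)"
    using Gs by (auto simp: d_sequence_def contraction_sequence_def)
  then obtain u v w where uvw: "u \<in> verts G" "v \<in> verts G" "u \<noteq> v" "w \<notin> verts G - {u, v}"
    "Gs s = contract (trigraph_of G) u v w"
    by (auto simp: contracts_to_def trigraph_of_def)
  have "w \<in> tverts (Gs s)" using uvw by (simp add: contract_def)
  then have "red_degree (Gs s) w \<le> tww G"
    using Gs s by (auto simp: d_sequence_def)
  then show ?thesis
    using red_degree_contract[OF assms(1) uvw(4)] uvw by force
qed


section \<open>The Sylvester--Hadamard matrix\<close>

text \<open>
  On indices below \<open>2 ^ (k + 1)\<close>, the lower \<open>k\<close> bits contribute their inner product and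
  the top bits of the row and of the column each contribute a global sign.
\<close>

primrec sylvester :: "nat \<Rightarrow> nat \<Rightarrow> nat \<Rightarrow> int" where
  "sylvester 0 i j = (-1) ^ (i + j)"
| "sylvester (Suc k) i j = (-1) ^ (i * j) * sylvester k (i div 2) (j div 2)"

lemma sylvester_commute: "sylvester k i j = sylvester k j i"
  by (induction k arbitrary: i j) (simp_all add: ac_simps)

lemma sylvester_values: "sylvester k i j = 1 \<or> sylvester k i j = -1"
proof (induction k arbitrary: i j)
  case 0
  show ?case by (auto simp: minus_one_power_iff)
next
  case (Suc k)
  show ?case using Suc[of "i div 2" "j div 2"] by (auto simp: minus_one_power_iff)
qed

lemma sylvester_zero: "j < 2 ^ k \<Longrightarrow> sylvester k 0 j = 1"
  by (induction k arbitrary: j) auto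

lemma sylvester_power_two: "sylvester k (2 ^ k) j = - sylvester k 0 j"
  by (induction k arbitrary: j) simp_all

lemma sum_lessThan_double:
  fixes f :: "nat \<Rightarrow> 'a::comm_monoid_add"
  shows "(\<Sum>j<2 * n. f j) = (\<Sum>j<n. f (2 * j) + f (2 * j + 1))"
  by (induction n) (simp_all add: ac_simps)

text \<open>Pairing columns \<open>2 * j\<close> and \<open>2 * j + 1\<close> splits off the factor
  \<open>1 + (-1) ^ (i + i')\<close>, which vanishes if the lowest bits differ; otherwise the higher
  bits differ and induction applies. The sum is negative, not zero, when only the top bits differ,
  since such rows are opposite.\<close>

lemma sylvester_rows:
  assumes "i \<noteq> i'" "i < 2 ^ Suc k" "i' < 2 ^ Suc k"
  shows "(\<Sum>j<2 ^ k. sylvester k i j * sylvester k i' j) \<le> 0"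
  using assms
proof (induction k arbitrary: i i')
  case 0
  then have "i = 0 \<and> i' = 1 \<or> i = 1 \<and> i' = 0" by auto
  then show ?case by auto
next
  case (Suc k)
  let ?S = "\<Sum>j<2 ^ k. sylvester k (i div 2) j * sylvester k (i' div 2) j"
  have "(\<Sum>j<2 ^ Suc k. sylvester (Suc k) i j * sylvester (Suc k) i' j) = (1 + (-1) ^ (i + i')) * ?S"
    unfolding power_Suc[of 2] sum_lessThan_double sum_distrib_left
    by (rule sum.cong) (auto simp: algebra_simps power_add minus_one_power_iff)
  also have "\<dots> \<le> 0"
  proof (cases "i div 2 = i' div 2")
    case True
    then have "odd (i + i')"
      using Suc.prems(1) by (metis dvd_mult_div_cancel even_add odd_two_times_div_two_succ)
    then show ?thesis by simp
  next
    case False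
    then have "?S \<le> 0" using Suc.IH[of "i div 2" "i' div 2"] Suc.prems by simp
    then show ?thesis by (simp add: minus_one_power_iff)
  qed
  finally show ?case .
qed

text \<open>
  Row \<open>0\<close>, which has no entry \<open>-1\<close> in the first \<open>2 ^ k\<close> columns, is traded for
  row \<open>2 ^ k\<close>, its negative.
\<close>

lemma sylvester_columns:
  assumes "j \<noteq> j'" "j < 2 ^ Suc k" "j' < 2 ^ Suc k"
  shows "(\<Sum>i = 1..2 ^ k. sylvester k i j * sylvester k i j') \<le> 0"
proof -
  let ?f = "\<lambda>i. sylvester k i j * sylvester k i j'"
  have "{1..2 ^ k} = insert (2 ^ k) {1..<2 ^ k :: nat}" by auto
  \<comment> \<open>Both factors change sign between rows \<open>2 ^ k\<close> and \<open>0\<close>,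
    so their product does not.\<close>
  then have "sum ?f {1..2 ^ k} = ?f 0 + sum ?f {1..<2 ^ k}"
    by (simp add: sylvester_power_two)
  also have "\<dots> = sum ?f (insert 0 {1..<2 ^ k})" by simp
  also have "insert 0 {1..<2 ^ k} = {..<2 ^ k :: nat}" by auto
  also have "sum ?f {..<2 ^ k} \<le> 0"
    using sylvester_rows[OF assms] by (simp add: sylvester_commute[of k _ j] sylvester_commute[of k _ j'])
  finally show ?thesis .
qed

text \<open>Each value is 1 minus twice the indicator of \<open>-1\<close>, so the sum is
  \<open>card A\<close> minus twice the count.\<close>

lemma card_minus_one_ge_half:
  fixes f :: "'a \<Rightarrow> int"
  assumes "finite A" "\<And>x. x \<in> A \<Longrightarrow> f x = 1 \<or> f x = -1" "sum f A \<le> 0"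
  shows "card A \<le> 2 * card {x \<in> A. f x = -1}"
proof -
  have "sum f A = (\<Sum>x\<in>A. 1 - 2 * (if f x = -1 then 1 else 0))"
    using assms(2) by (intro sum.cong) auto
  also have "\<dots> = int (card A) - 2 * int (card {x \<in> A. f x = -1})"
    using assms(1) by (simp add: sum_subtractf sum.If_cases flip: sum_distrib_left) (simp add: Int_def)
  finally show ?thesis using assms(3) by simp
qed


section \<open>The graphs\<close>

text \<open>
  The even vertex \<open>2 * i\<close> is row \<open>i \<ge> 1\<close>, the odd vertex \<open>2 * j + 1\<close> is column
  \<open>j \<ge> 0\<close>; the flag \<open>p\<close> turns the even side into a clique.
\<close>

definition hadamard_adj :: "bool \<Rightarrow> nat \<Rightarrow> nat \<Rightarrow> nat \<Rightarrow> bool" where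
  "hadamard_adj p k u v \<longleftrightarrow>
     (if even u \<and> even v then p else (even u \<noteq> even v) \<and>
        (if even u then sylvester k (u div 2) (v div 2) else sylvester k (v div 2) (u div 2)) = -1)"

definition hadamard_graph :: "bool \<Rightarrow> nat \<Rightarrow> nat \<Rightarrow> nat graph" where
  "hadamard_graph p k n = \<lparr> verts = {1..n},
     edges = {{u, v} | u v. u \<in> {1..n} \<and> v \<in> {1..n} \<and> u \<noteq> v \<and> hadamard_adj p k u v} \<rparr>"

lemma hadamard_adj_commute: "hadamard_adj p k u v = hadamard_adj p k v u"
  by (auto simp: hadamard_adj_def)

lemma verts_hadamard_graph [simp]: "verts (hadamard_graph p k n) = {1..n}"
  by (simp add: hadamard_graph_def)

lemma edges_hadamard_graph [simp]:
  "{u, v} \<in> edges (hadamard_graph p k n) \<longleftrightarrow>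
     u \<in> {1..n} \<and> v \<in> {1..n} \<and> u \<noteq> v \<and> hadamard_adj p k u v"
  by (auto simp: hadamard_graph_def doubleton_eq_iff hadamard_adj_commute)

lemma simple_hadamard_graph: "simple_graph (hadamard_graph p k n)"
proof -
  have "\<exists>u \<in> {1..n}. \<exists>v \<in> {1..n}. u \<noteq> v \<and> e = {u, v}" if "e \<in> edges (hadamard_graph p k n)" for e
    using that unfolding hadamard_graph_def graph.simps by blast
  then show ?thesis by (simp add: simple_graph_def)
qed

lemma hadamard_graph_bipartite: "hadamard_graph False k n \<in> bipartite_graphs"
proof -
  let ?G = "hadamard_graph False k n" and ?A = "{v \<in> {1..n}. even v}" and ?B = "{v \<in> {1..n}. odd v}"
  have "?A \<union> ?B = verts ?G \<and> ?A \<inter> ?B = {} \<and> stable_set ?G ?A \<and> stable_set ?G ?B"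
    by (auto simp: stable_set_def hadamard_adj_def)
  then show ?thesis unfolding bipartite_graphs_def using simple_hadamard_graph by blast
qed

lemma hadamard_graph_split: "hadamard_graph True k n \<in> split_graphs"
proof -
  let ?G = "hadamard_graph True k n" and ?A = "{v \<in> {1..n}. even v}" and ?B = "{v \<in> {1..n}. odd v}"
  have "?A \<union> ?B = verts ?G \<and> ?A \<inter> ?B = {} \<and> clique ?G ?A \<and> stable_set ?G ?B"
    by (auto simp: stable_set_def clique_def hadamard_adj_def)
  then show ?thesis unfolding split_graphs_def using simple_hadamard_graph by blast
qed

text \<open>Two vertices on one side differ at the opposite vertices where their signs have product
  \<open>-1\<close>. A row and a column differ at the other columns adjacent to the row, as columns
  are pairwise non-adjacent. The argument is the same for both values of \<open>p\<close>.\<close>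

lemma nbr_diff_hadamard_graph:
  assumes k: "2 ^ k \<le> n div 2" "n div 2 < 2 ^ Suc k"
    and uv: "u \<in> {1..n}" "v \<in> {1..n}" "u \<noteq> v"
  shows "2 ^ k \<le> 2 * (card (nbr_diff (hadamard_graph p k n) u v) + 1)"
proof -
  let ?D = "nbr_diff (hadamard_graph p k n)"
  have card_le: "card I \<le> card (?D a b)" if "f ` I \<subseteq> ?D a b" "inj f" for f :: "nat \<Rightarrow> nat" and I a b
  proof (rule card_inj_on_le[OF _ that(1)])
    show "inj_on f I" using that(2) by (rule inj_on_subset) simp
    show "finite (?D a b)" by (simp add: nbr_diff_def)
  qed
  \<comment> \<open>Only \<open>2 ^ k\<close> rows or columns serve for comparison, but the indices
    of \<open>u\<close> and \<open>v\<close> may reach \<open>n div 2\<close>.\<close>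
  have half: "u div 2 < 2 ^ Suc k" "v div 2 < 2 ^ Suc k"
    using k uv div_le_mono[of u n 2] div_le_mono[of v n 2] by auto
  have inj: "inj (\<lambda>j. 2 * j + 1 :: nat)" "inj (\<lambda>i. 2 * i :: nat)" by (auto simp: inj_on_def)
  have signs: "a * b = 1 \<or> a * b = -1" if "a = 1 \<or> a = -1" "b = 1 \<or> b = -1" for a b :: int
    using that by auto
  have mixed: "2 ^ k \<le> 2 * (card (?D a b) + 1)"
    if ab: "a \<in> {1..n}" "b \<in> {1..n}" "even a" "odd b" for a b
  proof -
    let ?I = "{j \<in> {..<2 ^ k}. sylvester k (a div 2) j = -1}"
    \<comment> \<open>Row \<open>0\<close> is constantly 1 on these columns, so comparison with it
      bounds the plain sum of row \<open>a div 2\<close>.\<close>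
    have "(\<Sum>j<2 ^ k. sylvester k 0 j * sylvester k (a div 2) j) \<le> 0"
    proof (rule sylvester_rows)
      show "0 \<noteq> a div 2" using ab by (auto elim!: evenE)
      show "a div 2 < 2 ^ Suc k" using k ab div_le_mono[of a n 2] by auto
    qed simp
    then have "(\<Sum>j<2 ^ k. sylvester k (a div 2) j) \<le> 0" by (simp add: sylvester_zero)
    then have I: "2 ^ k \<le> 2 * card ?I"
      using card_minus_one_ge_half[of "{..<2 ^ k}" "sylvester k (a div 2)"] sylvester_values by auto
    \<comment> \<open>The vertex \<open>b\<close> itself is excluded from \<open>nbr_diff\<close>;
      this lost column explains the \<open>+ 1\<close> in the bound.\<close>
    have "card ?I \<le> card (?I - {b div 2}) + 1"
      using diff_card_le_card_Diff[of "{b div 2}" ?I] by simp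
    also have "card (?I - {b div 2}) \<le> card (?D a b)"
    proof (rule card_le[OF _ inj(1)])
      show "(\<lambda>j. 2 * j + 1) ` (?I - {b div 2}) \<subseteq> ?D a b"
        using ab k(1) by (auto simp: nbr_diff_def hadamard_adj_def)
    qed
    finally have "card ?I \<le> card (?D a b) + 1" by simp
    then show ?thesis by (rule order_trans[OF I mult_le_mono2])
  qed
  consider "even u" "even v" | "odd u" "odd v" | "even u" "odd v" | "odd u" "even v" by blast
  then show ?thesis
  proof cases
    case 1
    let ?f = "\<lambda>j. sylvester k (u div 2) j * sylvester k (v div 2) j"
    let ?I = "{j \<in> {..<2 ^ k}. ?f j = -1}"
    have "u div 2 \<noteq> v div 2" using 1 uv(3) by (auto elim!: evenE)
    then have "2 ^ k \<le> 2 * card ?I"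
      using card_minus_one_ge_half[of "{..<2 ^ k}" ?f] sylvester_rows[OF _ half]
        signs[OF sylvester_values sylvester_values] by auto
    moreover have "card ?I \<le> card (?D u v)"
    proof (rule card_le[OF _ inj(1)])
      show "(\<lambda>j. 2 * j + 1) ` ?I \<subseteq> ?D u v"
        using 1 uv k(1) by (auto simp: nbr_diff_def hadamard_adj_def)
          (use sylvester_values in \<open>force+\<close>)
    qed
    ultimately show ?thesis by (elim order_trans[OF _ mult_le_mono2[OF trans_le_add1]])
  next
    case 2
    let ?f = "\<lambda>i. sylvester k i (u div 2) * sylvester k i (v div 2)"
    \<comment> \<open>Rows start at 1 because vertices do; the last vertex used,
      \<open>2 * 2 ^ k\<close>, is at most \<open>n\<close> by the lower bound on
      \<open>n div 2\<close>.\<close>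
    let ?I = "{i \<in> {1..2 ^ k}. ?f i = -1}"
    have "u div 2 \<noteq> v div 2" using 2 uv(3) by (auto elim!: oddE)
    then have "2 ^ k \<le> 2 * card ?I"
      using card_minus_one_ge_half[of "{1..2 ^ k}" ?f] sylvester_columns[OF _ half]
        signs[OF sylvester_values sylvester_values] by auto
    moreover have "card ?I \<le> card (?D u v)"
    proof (rule card_le[OF _ inj(2)])
      show "(\<lambda>i. 2 * i) ` ?I \<subseteq> ?D u v"
        using 2 uv k(1) by (auto simp: nbr_diff_def hadamard_adj_def)
          (use sylvester_values in \<open>force+\<close>)
    qed
    ultimately show ?thesis by (elim order_trans[OF _ mult_le_mono2[OF trans_le_add1]])
  next
    case 3
    then show ?thesis using mixed uv by blast
  next
    case 4
    then show ?thesis using mixed[of v u] uv by (simp add: nbr_diff_commute)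
  qed
qed

section \<open>The linear lower bound and the asymptotics\<close>

lemma ex_large_tww:
  fixes C :: "nat graph set"
  assumes C: "C \<in> {bipartite_graphs, split_graphs, cobipartite_graphs}" and n: "2 \<le> n"
  shows "\<exists>G \<in> C. simple_graph G \<and> card (verts G) = n \<and> n < 8 * (tww G + 1)"
proof -
  obtain k where k: "2 ^ k \<le> n div 2" "n div 2 < 2 ^ Suc k"
    using ex_power_ivl1[of 2 "n div 2"] n by (metis Suc_1 Suc_eq_plus1 div_greater_zero_iff less_eq_Suc_le One_nat_def order_refl pos2)
  \<comment> \<open>Asking only for equal \<open>nbr_diff\<close> sets lets one bound serve the
    complement too.\<close>
  have large: "n < 8 * (tww G + 1)"
    if G: "simple_graph G" "verts G = {1..n}"
      and D: "\<And>u v. u \<in> {1..n} \<Longrightarrow> v \<in> {1..n} \<Longrightarrow> nbr_diff G u v = nbr_diff (hadamard_graph p k n) u v"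
    for G p
  proof -
    obtain u v where uv: "u \<in> {1..n}" "v \<in> {1..n}" "u \<noteq> v" "card (nbr_diff G u v) \<le> tww G"
      using ex_nbr_diff_le_tww[OF G(1)] G(2) n by auto
    have "2 ^ k \<le> 2 * (tww G + 1)"
      using nbr_diff_hadamard_graph[OF k uv(1-3), of p] uv(4) D[OF uv(1,2)] by simp
    \<comment> \<open>Here \<open>n div 2 < 2 * 2 ^ k \<le> 4 * (tww G + 1)\<close>, whence the
      constant 8.\<close>
    then show ?thesis using k(2) by simp
  qed
  let ?B = "hadamard_graph False k n" and ?S = "hadamard_graph True k n"
  have "n < 8 * (tww ?B + 1)" "n < 8 * (tww ?S + 1)"
    by (rule large; simp add: simple_hadamard_graph)+
  moreover have "n < 8 * (tww (complement ?B) + 1)"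
    by (rule large[of _ False])
      (simp_all add: simple_hadamard_graph simple_graph_complement nbr_diff_complement,
       simp add: complement_def)
  moreover have "complement ?B \<in> cobipartite_graphs"
    by (simp add: cobipartite_graphs_def hadamard_graph_bipartite)
  moreover have "verts (complement ?B) = {1..n}" by (simp add: complement_def)
  moreover have "simple_graph ?B" "simple_graph ?S" "simple_graph (complement ?B)"
    by (simp_all add: simple_hadamard_graph simple_graph_complement)
  moreover note hadamard_graph_bipartite[of k n] hadamard_graph_split[of k n]
  ultimately have "\<exists>G \<in> C. simple_graph G \<and> verts G = {1..n} \<and> n < 8 * (tww G + 1)"
    using C verts_hadamard_graph by (elim insertE emptyE) (simp_all only:, blast+)
  then show ?thesis by force
qed

theorem lemmaA1:
  fixes C :: "nat graph set"
  assumes "C \<in> {bipartite_graphs, split_graphs, cobipartite_graphs}"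
  shows "(\<lambda>n. real (max_tww C n)) \<in> \<Theta>(\<lambda>n. real n)"
proof -
  have simple: "simple_graph G" if "G \<in> C" for G
    using assms that
    by (auto simp: bipartite_graphs_def split_graphs_def cobipartite_graphs_def
        simple_graph_complement)
  have bounds: "max_tww C n \<le> n \<and> n < 8 * (max_tww C n + 1)" if n: "2 \<le> n" for n
  proof -
    let ?W = "{tww G | G. G \<in> C \<and> card (verts G) = n}"
    \<comment> \<open>The upper bound also makes the set finite, so that \<open>Max\<close> is
      attained.\<close>
    have sub: "?W \<subseteq> {..n}" using tww_le_card simple n by fastforce
    then have fin: "finite ?W" by (rule finite_subset) simp
    obtain G where G: "G \<in> C" "card (verts G) = n" "n < 8 * (tww G + 1)"
      using ex_large_tww[OF assms n] by blast
    then have mem: "tww G \<in> ?W" by blast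
    then have "Max ?W \<in> ?W" using fin by (intro Max_in) auto
    moreover have "tww G \<le> Max ?W" using fin mem by (rule Max_ge)
    ultimately show ?thesis using sub G(3) unfolding max_tww_def by auto
  qed
  show ?thesis
  proof (rule bigthetaI)
    show "(\<lambda>n. real (max_tww C n)) \<in> O(\<lambda>n. real n)"
      by (rule bigoI[of _ 1]) (use bounds in \<open>auto simp: eventually_at_top_linorder\<close>)
    \<comment> \<open>For \<open>16 \<le> n\<close> the additive 8 is at most half of
      \<open>n\<close>, which doubles the constant 8 to 16.\<close>
    have "norm (real n) \<le> 16 * norm (real (max_tww C n))" if "16 \<le> n" for n
      using bounds[of n] that by simp
    then have "(\<lambda>n. real n) \<in> O(\<lambda>n. real (max_tww C n))"
      by (intro bigoI[of _ 16]) (auto simp: eventually_at_top_linorder)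
    then show "(\<lambda>n. real (max_tww C n)) \<in> \<Omega>(\<lambda>n. real n)"
      by (simp add: bigomega_iff_bigo)
  qed
qed

end
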